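(* Let $T$ and $T'$ be the following rooted trees on 14 vertices, where $\bullet$ denotes a single-vertex tree and $[S_1,\dots,S_r]$ denotes the rooted tree whose root has as child subtrees exactly $S_1,\dots,S_r$: $$T=\big[\;[\,[\,[\bullet,\bullet],\bullet,\bullet\,]\,],\;\bullet,\;[\,[\,[\bullet],\bullet\,]\,]\;\big],\qquad T'=\big[\;[\,[\,[\bullet,\bullet],\bullet\,],\bullet\,],\;[\,\bullet,[\,[\bullet],\bullet\,]\,]\;\big].$$ Then $T$ and $T'$ have the same multiset of hook values, but the order polytopes $\mathcal{O}(T)$ and $\mathcal{O}(T')$ have different Ehrhart polynomials.
   Context: A rooted tree is regarded as a poset in which the root is the minimum element and $u\le v$ iff $u$ lies on the path from the root to $v$. The hook value of a vertex $v$ is the number of vertices in the subtree rooted at $v$ (including $v$); the multiset of hook values is taken over all vertices. For a finite poset $P$ on $[n]=\{1,\dots,n\}$, the order polytope $\mathcal{O}(P)\subset\mathbb{R}^n$ is defined by the inequalities $x_i\le x_j$ whenever $i<_P j$, and $0\le x_i\le 1$ for $1\le i\le n$. (It has integer vertices.) For a polytope $\mathcal{P}\subset\mathbb{R}^n$ with integer vertices, the Ehrhart polynomial is the polynomial $\mathrm{ehr}_{\mathcal{P}}$ with $\mathrm{ehr}_{\mathcal{P}}(k)=\#(k\mathcal{P}\cap\mathbb{Z}^n)$ for all positive integers $k$. *)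

theory Defs
  imports "HOL-Analysis.Analysis" "HOL-Library.Sublist" "HOL-Library.Multiset"
    "HOL-Computational_Algebra.Polynomial"
begin

datatype rtree = Node "rtree list"

abbreviation leaf :: rtree where
  "leaf \<equiv> Node []"

text \<open>A vertex is the address of a node: the sequence of child positions on the path from
  the root to it. So \<open>u\<close> lies on the path from the root to \<open>v\<close> iff \<open>u\<close> is a prefix of \<open>v\<close>.\<close>

fun is_vertex :: "rtree \<Rightarrow> nat list \<Rightarrow> bool" where
  "is_vertex t [] = True"
| "is_vertex (Node ts) (i # p) = (i < length ts \<and> is_vertex (ts ! i) p)"

definition vertices :: "rtree \<Rightarrow> nat list set" where
  "vertices t = {p. is_vertex t p}"

definition hook_value :: "rtree \<Rightarrow> nat list \<Rightarrow> nat" where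
  "hook_value t v = card {w \<in> vertices t. prefix v w}"

definition hook_values :: "rtree \<Rightarrow> nat multiset" where
  "hook_values t = image_mset (hook_value t) (mset_set (vertices t))"

definition order_polytope :: "('n::finite \<Rightarrow> 'n \<Rightarrow> bool) \<Rightarrow> (real ^ 'n) set" where
  "order_polytope le =
     {x. (\<forall>i j. le i j \<longrightarrow> x $ i \<le> x $ j) \<and> (\<forall>i. 0 \<le> x $ i \<and> x $ i \<le> 1)}"

text \<open>A labelling \<open>lab\<close> of the vertices of \<open>t\<close> by the coordinates (a bijection from the index
  type onto \<open>vertices t\<close>) transports the tree order to the index type.\<close>

definition labelling :: "rtree \<Rightarrow> ('n::finite \<Rightarrow> nat list) \<Rightarrow> bool" where
  "labelling t lab \<longleftrightarrow> bij_betw lab UNIV (vertices t)"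

definition tree_le :: "('n::finite \<Rightarrow> nat list) \<Rightarrow> 'n \<Rightarrow> 'n \<Rightarrow> bool" where
  "tree_le lab i j \<longleftrightarrow> prefix (lab i) (lab j)"

definition integer_points :: "(real ^ 'n::finite) set" where
  "integer_points = {x. \<forall>i. x $ i \<in> \<int>}"

definition is_ehrhart_poly :: "(real ^ 'n::finite) set \<Rightarrow> real poly \<Rightarrow> bool" where
  "is_ehrhart_poly P p \<longleftrightarrow>
     (\<forall>k::nat. k > 0 \<longrightarrow>
        poly p (real k) = real (card ((\<lambda>x. real k *\<^sub>R x) ` P \<inter> integer_points)))"

lemma is_ehrhart_poly_unique:
  assumes "is_ehrhart_poly P p" and "is_ehrhart_poly P q"
  shows "p = q"
proof -
  have "poly (p - q) (real k) = 0" if "k \<in> {0<..}" for k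
    using assms that by (simp add: is_ehrhart_poly_def)
  then have "real ` {0<..} \<subseteq> {x. poly (p - q) x = 0}" by auto
  moreover have "infinite (real ` {0::nat<..})"
    by (simp add: finite_image_iff infinite_Ioi inj_on_def)
  ultimately have "infinite {x. poly (p - q) x = 0}"
    using finite_subset by blast
  then show ?thesis
    using poly_roots_finite[of "p - q"] by auto
qed

definition treeT :: rtree where
  "treeT =
     Node [Node [Node [Node [leaf, leaf], leaf, leaf]],
           leaf,
           Node [Node [Node [leaf], leaf]]]"

definition treeT' :: rtree where
  "treeT' =
     Node [Node [Node [Node [leaf, leaf], leaf], leaf],
           Node [leaf, Node [Node [leaf], leaf]]]"

lemma vertices_Node:
  "vertices (Node ts) = insert [] (\<Union>i<length ts. (#) i ` vertices (ts ! i))"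
proof (rule set_eqI)
  fix p show "p \<in> vertices (Node ts) \<longleftrightarrow>
      p \<in> insert [] (\<Union>i<length ts. (#) i ` vertices (ts ! i))"
    by (cases p) (auto simp: vertices_def)
qed

lemma card_vertices_treeT: "card (vertices treeT) = 14"
  and card_vertices_treeT': "card (vertices treeT') = 14"
  by (simp_all add: treeT_def treeT'_def vertices_Node lessThan_Suc)

lemma ex_labelling:
  assumes "card (vertices t) = CARD('n::finite)"
  shows "\<exists>lab :: 'n \<Rightarrow> nat list. labelling t lab"
proof -
  have "finite (vertices t)"
    using assms card.infinite[of "vertices t"] by force
  then show ?thesis
    using assms finite_same_card_bij[of "UNIV :: 'n set" "vertices t"]
    by (simp add: labelling_def)
qed

end

theory Submission imports Defs begin

text \<open>Reversing \<open>j \<mapsto> k - j\<close> turns lattice points of the \<open>k\<close>-fold order polytope of a tree into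
  labellings by \<open>{..k}\<close> that decrease away from the root. Summing over the label \<open>j\<close> of the root,
  the labellings of the child subtrees are independent with labels in \<open>{..j}\<close>, so the
  number of labellings satisfies a recursion over the tree. Polynomiality follows since summation and
  products preserve polynomials, and already the values at \<open>k = 1\<close> differ: 353 against 346.\<close>

section \<open>Hook values\<close>

lemma finite_vertices: "finite (vertices t)"
proof (induction t)
  case (Node ts)
  then show ?case by (simp add: vertices_Node)
qed

lemma Nil_in_vertices [simp]: "[] \<in> vertices t"
  by (simp add: vertices_def)

lemma Cons_in_vertices_iff:
  "i # p \<in> vertices (Node ts) \<longleftrightarrow> i < length ts \<and> p \<in> vertices (ts ! i)"
  by (simp add: vertices_def)

lemma card_vertices_Node:
  "card (vertices (Node ts)) = Suc (\<Sum>i<length ts. card (vertices (ts ! i)))"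
proof -
  have "card (\<Union>i<length ts. (#) i ` vertices (ts ! i)) = (\<Sum>i<length ts. card (vertices (ts ! i)))"
    by (subst card_UN_disjoint) (auto simp: finite_vertices card_image)
  then show ?thesis
    unfolding vertices_Node by (subst card_insert_disjoint) (auto simp: finite_vertices)
qed

lemma hook_value_Nil: "hook_value t [] = card (vertices t)"
  by (simp add: hook_value_def)

lemma hook_value_Cons:
  assumes "i < length ts"
  shows "hook_value (Node ts) (i # p) = hook_value (ts ! i) p"
proof -
  have "{w \<in> vertices (Node ts). prefix (i # p) w} = (#) i ` {w \<in> vertices (ts ! i). prefix p w}"
  proof (rule set_eqI)
    fix w
    show "w \<in> {w \<in> vertices (Node ts). prefix (i # p) w} \<longleftrightarrow>
      w \<in> (#) i ` {w \<in> vertices (ts ! i). prefix p w}"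
      using assms by (cases w) (auto simp: Cons_in_vertices_iff)
  qed
  then show ?thesis by (simp add: hook_value_def card_image)
qed

lemma mset_set_UN_disjoint:
  assumes "finite I" "\<And>i. i \<in> I \<Longrightarrow> finite (A i)"
    "\<And>i j. i \<in> I \<Longrightarrow> j \<in> I \<Longrightarrow> i \<noteq> j \<Longrightarrow> A i \<inter> A j = {}"
  shows "mset_set (\<Union>i\<in>I. A i) = (\<Sum>i\<in>I. mset_set (A i))"
  using assms
proof (induction I rule: finite_induct)
  case (insert x F)
  have "A x \<inter> (\<Union>i\<in>F. A i) = {}"
    using insert.prems(2) insert.hyps(2) by fastforce
  then have "mset_set (A x \<union> (\<Union>i\<in>F. A i)) = mset_set (A x) + mset_set (\<Union>i\<in>F. A i)"
    using insert.prems(1) insert.hyps(1) by (intro mset_set_Union) auto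
  then show ?case using insert by simp
qed simp

lemma image_mset_sum: "image_mset f (\<Sum>i\<in>I. M i) = (\<Sum>i\<in>I. image_mset f (M i))"
  by (induction I rule: infinite_finite_induct) auto

text \<open>All descendants of a non-root vertex lie in its own child subtree, so passing to that
  subtree preserves its hook value. This gives a recursion that rewriting can evaluate on concrete
  trees.\<close>

lemma hook_values_Node:
  "hook_values (Node ts) =
     add_mset (card (vertices (Node ts))) (\<Sum>i<length ts. hook_values (ts ! i))"
proof -
  have "mset_set (vertices (Node ts)) =
      add_mset [] (mset_set (\<Union>i<length ts. (#) i ` vertices (ts ! i)))"
    unfolding vertices_Node by (subst mset_set.insert) (auto simp: finite_vertices)
  also have "mset_set (\<Union>i<length ts. (#) i ` vertices (ts ! i)) =
      (\<Sum>i<length ts. image_mset ((#) i) (mset_set (vertices (ts ! i))))"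
    by (subst mset_set_UN_disjoint) (auto simp: finite_vertices image_mset_mset_set)
  finally have *: "mset_set (vertices (Node ts)) =
      add_mset [] (\<Sum>i<length ts. image_mset ((#) i) (mset_set (vertices (ts ! i))))" .
  show ?thesis
    unfolding hook_values_def *
    by (auto simp: image_mset_sum hook_value_Nil hook_value_Cons multiset.map_comp comp_def
        intro!: sum.cong image_mset_cong)
qed

text \<open>Both sides evaluate to 14, 7, 6, 5, 4, 3, 2 and seven copies of 1.\<close>

lemma hook_values_treeT_eq: "hook_values treeT = hook_values treeT'"
  by (simp add: treeT_def treeT'_def hook_values_Node card_vertices_Node lessThan_Suc)

section \<open>Counting order-reversing maps\<close>

text \<open>Stanley's P-partitions of the tree with parts at most \<open>k\<close>. Extensional
  functions are used so that each labelling of the vertices is counted once.\<close>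

definition antitone_maps :: "rtree \<Rightarrow> nat \<Rightarrow> (nat list \<Rightarrow> nat) set" where
  "antitone_maps t k =
     {f \<in> vertices t \<rightarrow>\<^sub>E {..k}. \<forall>u \<in> vertices t. \<forall>v \<in> vertices t. prefix u v \<longrightarrow> f v \<le> f u}"

fun count_maps :: "rtree \<Rightarrow> nat \<Rightarrow> nat" where
  "count_maps (Node ts) k = (\<Sum>j\<le>k. \<Prod>t\<leftarrow>ts. count_maps t j)"

lemma finite_antitone_maps: "finite (antitone_maps t k)"
  by (rule finite_subset[of _ "vertices t \<rightarrow>\<^sub>E {..k}"])
    (auto simp: antitone_maps_def finite_vertices intro!: finite_PiE)

text \<open>Vertices in different child subtrees are incomparable, so once the root label
  \<open>j\<close> is fixed the only link left between the children is the common cap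
  \<open>j\<close>. The inverse reads off the root label and the restriction to each child.\<close>

lemma antitone_maps_Node_bij:
  "bij_betw (\<lambda>(j, g). restrict (\<lambda>p. case p of [] \<Rightarrow> j | i # q \<Rightarrow> g i q) (vertices (Node ts)))
     (SIGMA j:{..k}. \<Pi>\<^sub>E i\<in>{..<length ts}. antitone_maps (ts ! i) j) (antitone_maps (Node ts) k)"
  (is "bij_betw ?F ?A ?B")
proof (rule bij_betw_byWitness
    [where f' = "\<lambda>f. (f [], \<lambda>i\<in>{..<length ts}. \<lambda>p\<in>vertices (ts ! i). f (i # p))"])
  show "\<forall>a\<in>?A. (?F a [], \<lambda>i\<in>{..<length ts}. \<lambda>p\<in>vertices (ts ! i). ?F a (i # p)) = a"
  proof
    fix a assume "a \<in> ?A"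
    then obtain j g where a: "a = (j, g)"
      and g: "g \<in> (\<Pi>\<^sub>E i\<in>{..<length ts}. antitone_maps (ts ! i) j)" by auto
    have "(\<lambda>i\<in>{..<length ts}. \<lambda>p\<in>vertices (ts ! i). ?F (j, g) (i # p)) = g"
    proof
      fix i
      show "(\<lambda>i\<in>{..<length ts}. \<lambda>p\<in>vertices (ts ! i). ?F (j, g) (i # p)) i = g i"
      proof (cases "i < length ts")
        case True
        then have "g i \<in> vertices (ts ! i) \<rightarrow>\<^sub>E {..j}"
          using g by (auto simp: antitone_maps_def dest: PiE_mem)
        \<comment> \<open>Extensionality of \<open>g i\<close>: restricting it to the vertices of
          the child changes nothing.\<close>
        then have "g i p = undefined" if "p \<notin> vertices (ts ! i)" for p
          using that by (rule PiE_arb)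
        with True show ?thesis by (intro ext) (simp add: Cons_in_vertices_iff)
      next
        case False
        then show ?thesis using PiE_arb[OF g, of i] by simp
      qed
    qed
    then show "(?F a [], \<lambda>i\<in>{..<length ts}. \<lambda>p\<in>vertices (ts ! i). ?F a (i # p)) = a"
      by (simp add: a)
  qed
  show "\<forall>f\<in>?B. ?F (f [], \<lambda>i\<in>{..<length ts}. \<lambda>p\<in>vertices (ts ! i). f (i # p)) = f"
  proof
    fix f assume "f \<in> ?B"
    then have f: "f \<in> vertices (Node ts) \<rightarrow>\<^sub>E {..k}" by (simp add: antitone_maps_def)
    show "?F (f [], \<lambda>i\<in>{..<length ts}. \<lambda>p\<in>vertices (ts ! i). f (i # p)) = f"
    proof
      fix p
      show "?F (f [], \<lambda>i\<in>{..<length ts}. \<lambda>p\<in>vertices (ts ! i). f (i # p)) p = f p"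
        using PiE_arb[OF f] by (cases p) (auto simp: Cons_in_vertices_iff)
    qed
  qed
  show "?F ` ?A \<subseteq> ?B"
  proof (rule image_subsetI)
    fix a assume "a \<in> ?A"
    then obtain j g where a: "a = (j, g)" and j: "j \<in> {..k}"
      and "g \<in> (\<Pi>\<^sub>E i\<in>{..<length ts}. antitone_maps (ts ! i) j)" by auto
    then have g: "g i \<in> antitone_maps (ts ! i) j" if "i < length ts" for i
      using that by (auto dest: PiE_mem)
    then have le: "g i p \<le> j" if "i < length ts" "p \<in> vertices (ts ! i)" for i p
      using that by (fastforce simp: antitone_maps_def dest: PiE_mem)
    \<comment> \<open>If \<open>u\<close> is the root, the cap \<open>j\<close> suffices; otherwise
      \<open>u\<close> and \<open>v\<close> start with the same child index and the order condition
      in that child applies.\<close>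
    have "?F (j, g) v \<le> ?F (j, g) u"
      if "u \<in> vertices (Node ts)" "v \<in> vertices (Node ts)" "prefix u v" for u v
      using that g le by (cases u; cases v) (auto simp: Cons_in_vertices_iff antitone_maps_def)
    moreover have "?F (j, g) p \<le> k" if "p \<in> vertices (Node ts)" for p
      using that le j by (cases p) (auto simp: Cons_in_vertices_iff intro: le_trans)
    ultimately show "?F a \<in> ?B" by (auto simp: a antitone_maps_def)
  qed
  \<comment> \<open>The cap \<open>f []\<close> on each child comes from the root being a prefix of
    every vertex.\<close>
  show "(\<lambda>f. (f [], \<lambda>i\<in>{..<length ts}. \<lambda>p\<in>vertices (ts ! i). f (i # p))) ` ?B \<subseteq> ?A"
    by (auto simp: antitone_maps_def Cons_in_vertices_iff dest: PiE_mem)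
qed

lemma card_antitone_maps: "card (antitone_maps t k) = count_maps t k"
proof (induction t arbitrary: k)
  case (Node ts)
  have "card (antitone_maps (Node ts) k) =
      card (SIGMA j:{..k}. \<Pi>\<^sub>E i\<in>{..<length ts}. antitone_maps (ts ! i) j)"
    using bij_betw_same_card[OF antitone_maps_Node_bij] by metis
  also have "\<dots> = (\<Sum>j\<le>k. \<Prod>i<length ts. card (antitone_maps (ts ! i) j))"
    by (simp add: card_SigmaI card_PiE finite_PiE finite_antitone_maps)
  also have "\<dots> = (\<Sum>j\<le>k. \<Prod>t\<leftarrow>ts. count_maps t j)"
    by (simp add: Node.IH prod.list_conv_set_nth atLeast0LessThan)
  finally show ?case by simp
qed

section \<open>Lattice points of dilated order polytopes\<close>

text \<open>The order inequalities are homogeneous, so dilation only moves the upper bound from 1 to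
  \<open>k\<close>; the converse inclusion divides by \<open>k\<close>.\<close>

lemma scaled_order_polytope:
  fixes le :: "'n::finite \<Rightarrow> 'n \<Rightarrow> bool"
  assumes "k > 0"
  shows "(\<lambda>x. real k *\<^sub>R x) ` order_polytope le =
    {x. (\<forall>i j. le i j \<longrightarrow> x $ i \<le> x $ j) \<and> (\<forall>i. 0 \<le> x $ i \<and> x $ i \<le> real k)}"
    (is "_ = ?R")
proof
  show "(\<lambda>x. real k *\<^sub>R x) ` order_polytope le \<subseteq> ?R"
    using assms by (auto simp: order_polytope_def mult_left_le)
  show "?R \<subseteq> (\<lambda>x. real k *\<^sub>R x) ` order_polytope le"
  proof
    fix x assume "x \<in> ?R"
    then have "(1 / real k) *\<^sub>R x \<in> order_polytope le"
      using assms by (auto simp: order_polytope_def divide_right_mono)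
    moreover have "x = real k *\<^sub>R ((1 / real k) *\<^sub>R x)" using assms by simp
    ultimately show "x \<in> (\<lambda>x. real k *\<^sub>R x) ` order_polytope le" by blast
  qed
qed

lemma card_lattice_points:
  fixes lab :: "'n::finite \<Rightarrow> nat list"
  assumes lab: "labelling t lab" and k: "k > 0"
  shows "card ((\<lambda>x. real k *\<^sub>R x) ` order_polytope (tree_le lab) \<inter> integer_points) = count_maps t k"
proof -
  let ?L = "(\<lambda>x. real k *\<^sub>R x) ` order_polytope (tree_le lab) \<inter> integer_points"
  \<comment> \<open>\<open>F\<close> and \<open>G\<close> are the reversal in both directions. The
    natural-number subtraction loses nothing on the maps considered, whose values are at most
    \<open>k\<close>.\<close>
  define F :: "(nat list \<Rightarrow> nat) \<Rightarrow> real ^ 'n" where "F f = (\<chi> i. real (k - f (lab i)))" for f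
  define G :: "real ^ 'n \<Rightarrow> nat list \<Rightarrow> nat" where
    "G x = (\<lambda>v\<in>vertices t. k - nat \<lfloor>x $ inv lab v\<rfloor>)" for x
  have inj: "inj lab" and range: "range lab = vertices t"
    using lab by (auto simp: labelling_def bij_betw_def)
  have [simp]: "inv lab (lab i) = i" for i using inj by simp
  have lab_inv: "lab (inv lab v) = v" if "v \<in> vertices t" for v
    using that range by (simp add: f_inv_into_f)
  have lab_in [simp]: "lab i \<in> vertices t" for i using range by auto
  have "bij_betw F (antitone_maps t k) ?L"
  proof (rule bij_betw_byWitness[where f' = G])
    show "\<forall>f\<in>antitone_maps t k. G (F f) = f"
    proof
      fix f assume "f \<in> antitone_maps t k"
      then have f: "f \<in> vertices t \<rightarrow>\<^sub>E {..k}" by (simp add: antitone_maps_def)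
      show "G (F f) = f"
      proof
        fix v
        show "G (F f) v = f v"
          using PiE_arb[OF f] PiE_mem[OF f, of v] by (auto simp: G_def F_def lab_inv)
      qed
    qed
    show "\<forall>x\<in>?L. F (G x) = x"
    proof
      fix x assume x: "x \<in> ?L"
      \<comment> \<open>The coordinate is an integer between 0 and \<open>k\<close>, so floor,
        \<open>nat\<close> and both subtractions are exact.\<close>
      have "real (k - (k - nat \<lfloor>x $ i\<rfloor>)) = x $ i" for i
      proof -
        have *: "0 \<le> x $ i" "x $ i \<le> real k" "x $ i \<in> \<int>"
          using x k by (auto simp: scaled_order_polytope integer_points_def)
        then obtain z where "x $ i = of_int z" by (auto elim: Ints_cases)
        with * show ?thesis by (simp add: nat_le_iff)
      qed
      then show "F (G x) = x" by (simp add: F_def G_def vec_eq_iff)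
    qed
    show "F ` antitone_maps t k \<subseteq> ?L"
      using k by (auto simp: scaled_order_polytope integer_points_def F_def antitone_maps_def
          tree_le_def intro!: diff_le_mono2)
    show "G ` ?L \<subseteq> antitone_maps t k"
    proof (rule image_subsetI)
      fix x assume "x \<in> ?L"
      then have mono: "x $ inv lab u \<le> x $ inv lab v"
        if "u \<in> vertices t" "v \<in> vertices t" "prefix u v" for u v
        using that k by (auto simp: scaled_order_polytope tree_le_def lab_inv)
      show "G x \<in> antitone_maps t k"
        by (auto simp: antitone_maps_def G_def intro!: diff_le_mono2 nat_mono floor_mono mono)
    qed
  qed
  then show ?thesis by (metis bij_betw_same_card card_antitone_maps)
qed

section \<open>Polynomiality\<close>

text \<open>Faulhaber's theorem in existence form, by strong induction on the exponent.\<close>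

lemma sum_powers_polynomial:
  "\<exists>q :: real poly. \<forall>k. poly q (real k) = (\<Sum>j\<le>k. real j ^ n)"
proof (induction n rule: less_induct)
  case (less n)
  then obtain S :: "nat \<Rightarrow> real poly"
    where S: "\<And>i k. i < n \<Longrightarrow> poly (S i) (real k) = (\<Sum>j\<le>k. real j ^ i)"
    by metis
  define q where
    \<comment> \<open>The identity proved below, solved for the sum of \<open>n\<close>-th powers,
      which occurs there with coefficient \<open>Suc n choose n\<close>, that is
      \<open>Suc n\<close>.\<close>
    "q = smult (1 / real (Suc n)) ([:1, 1:] ^ Suc n - (\<Sum>i<n. smult (real (Suc n choose i)) (S i)))"
  have "poly q (real k) = (\<Sum>j\<le>k. real j ^ n)" for k
  proof -
    \<comment> \<open>Telescope \<open>(j + 1)\<^sup>n\<^sup>+\<^sup>1 - j\<^sup>n\<^sup>+\<^sup>1\<close> and expand binomially.\<close>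
    have "(1 + real k) ^ Suc n = (\<Sum>j\<le>k. (1 + real j) ^ Suc n - real j ^ Suc n)"
      by (induction k) (auto simp: algebra_simps)
    also have "\<dots> = (\<Sum>j\<le>k. \<Sum>i\<le>n. real (Suc n choose i) * real j ^ i)"
      by (intro sum.cong refl, subst add.commute, subst binomial_ring) simp
    also have "\<dots> = (\<Sum>i\<le>n. real (Suc n choose i) * (\<Sum>j\<le>k. real j ^ i))"
      by (subst sum.swap) (simp add: sum_distrib_left)
    also have "\<dots> = (\<Sum>i<n. real (Suc n choose i) * (\<Sum>j\<le>k. real j ^ i))
        + real (Suc n) * (\<Sum>j\<le>k. real j ^ n)"
      by (simp add: lessThan_Suc_atMost[symmetric])
    finally show ?thesis
      by (simp add: q_def poly_sum S field_simps del: power_Suc of_nat_Suc binomial_Suc_Suc)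
  qed
  then show ?case by blast
qed

text \<open>By linearity: expand \<open>p\<close> into monomials and exchange the two sums.\<close>

lemma sum_poly_polynomial:
  fixes p :: "real poly"
  shows "\<exists>q. \<forall>k. poly q (real k) = (\<Sum>j\<le>k. poly p (real j))"
proof -
  obtain S :: "nat \<Rightarrow> real poly" where S: "\<And>n k. poly (S n) (real k) = (\<Sum>j\<le>k. real j ^ n)"
    using sum_powers_polynomial by metis
  have "poly (\<Sum>i\<le>degree p. smult (coeff p i) (S i)) (real k) = (\<Sum>j\<le>k. poly p (real j))" for k
    unfolding poly_altdef[of p] by (subst sum.swap) (simp add: poly_sum S sum_distrib_left)
  then show ?thesis by blast
qed

text \<open>By induction the summand is a product of polynomials in the root label \<open>j\<close>,
  and summing it over \<open>j\<close> up to \<open>k\<close> again gives a polynomial in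
  \<open>k\<close>.\<close>

lemma count_maps_polynomial: "\<exists>p :: real poly. \<forall>k. poly p (real k) = real (count_maps t k)"
proof (induction t)
  case (Node ts)
  then obtain P :: "rtree \<Rightarrow> real poly"
    where P: "\<And>t k. t \<in> set ts \<Longrightarrow> poly (P t) (real k) = real (count_maps t k)"
    by metis
  have "poly (\<Prod>t\<leftarrow>ts. P t) (real k) = real (\<Prod>t\<leftarrow>ts. count_maps t k)" for k
    using P by (induction ts) auto
  with sum_poly_polynomial[of "\<Prod>t\<leftarrow>ts. P t"] show ?case by simp
qed

text \<open>The second property makes values of the Ehrhart polynomial computable from the tree
  alone, independently of the labelling.\<close>

lemma order_polytope_tree_ehrhart:
  fixes lab :: "'n::finite \<Rightarrow> nat list"
  assumes "labelling t lab"
  obtains p where "is_ehrhart_poly (order_polytope (tree_le lab)) p"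
    and "\<And>k. poly p (real k) = real (count_maps t k)"
  using count_maps_polynomial[of t] card_lattice_points[OF assms]
  by (auto simp: is_ehrhart_poly_def)

theorem mainTheorem4:
  "hook_values treeT = hook_values treeT' \<and>
   (\<forall>(lab :: 14 \<Rightarrow> nat list) (lab' :: 14 \<Rightarrow> nat list).
      labelling treeT lab \<longrightarrow> labelling treeT' lab' \<longrightarrow>
      (\<exists>p p'. is_ehrhart_poly (order_polytope (tree_le lab)) p \<and>
              is_ehrhart_poly (order_polytope (tree_le lab')) p' \<and>
              p \<noteq> p'))"
proof (intro conjI allI impI)
  show "hook_values treeT = hook_values treeT'" by (rule hook_values_treeT_eq)
next
  fix lab lab' :: "14 \<Rightarrow> nat list"
  assume "labelling treeT lab" "labelling treeT' lab'"
  then obtain p p' where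
    p: "is_ehrhart_poly (order_polytope (tree_le lab)) p"
      "\<And>k. poly p (real k) = real (count_maps treeT k)" and
    p': "is_ehrhart_poly (order_polytope (tree_le lab')) p'"
      "\<And>k. poly p' (real k) = real (count_maps treeT' k)"
    by (metis order_polytope_tree_ehrhart)
  \<comment> \<open>At \<open>k = 1\<close> the summand for root label 0 is 1, so each value is 1
    plus the product of the values of the children; a leaf has value 2. At the roots this reads 353
    = 1 + 22 * 2 * 8 and 346 = 1 + 23 * 15.\<close>
  have "count_maps treeT 1 = 353" "count_maps treeT' 1 = 346"
    by (simp_all add: treeT_def treeT'_def)
  with p(2)[of 1] p'(2)[of 1] have "p \<noteq> p'" by auto
  with p(1) p'(1) show "\<exists>p p'. is_ehrhart_poly (order_polytope (tree_le lab)) p \<and>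
      is_ehrhart_poly (order_polytope (tree_le lab')) p' \<and> p \<noteq> p'" by blast
qed

end
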